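(* In the setting described in the context (a Borel summable transseries solution $\tilde{\mathbf x}$ of the nonresonant difference system, with Borel sum $$\mathbf x(t)=\sum_{\mathbf k\in\mathbb N^{l}}\mathbf C^{\mathbf k}e^{-\mathbf k\cdot\boldsymbol\mu t}t^{\mathbf k\cdot\mathbf a}\mathbf x_{\mathbf k}(t),\qquad \Re(t)>t_0,$$ which is taken as the continuation to the half plane $\{t:\Re(t)>t_0\}$ of the solution $\mathbf x(n)$), the following uniqueness property holds: if $\mathbf x(n)=0$ for all except possibly finitely many $n\in\mathbb N$, then $\mathbf x(t)=0$ for all $t\in\mathbb C$ with $\Re(t)>t_0$.
   Context: $\mathbb N$ contains $0$. For $\mathbf k=(k_1,\dots,k_m)$, $|\mathbf k|=\sum_j k_j$, $\mathbf C^{\mathbf k}=\prod_j C_j^{k_j}$. System. Consider $$\mathbf x(n+1)=\hat\Lambda\Big(I+\tfrac1n\hat A\Big)\mathbf x(n)+\mathbf g(n,\mathbf x(n)),\qquad \mathbf x(n)\in\mathbb C^m,$$ with constant matrices $\hat\Lambda,\hat A$, where $\mathbf g(n,\mathbf x)=\sum_{\mathbf k\in\mathbb N^m}\mathbf g_{\mathbf k}(n)\mathbf x^{\mathbf k}$ converges for small $\mathbf x$, each $\mathbf g_{\mathbf k}(n)$ is analytic in $n$ at infinity, and $\mathbf g_{\mathbf k}(n)=O(n^{-2})$ as $n\to\infty$ if $|\mathbf k|\le 1$. Let $e^{-\mu_1},\dots,e^{-\mu_m}$ be the eigenvalues of $\hat\Lambda$ and $a_1,\dots,a_m$ those of $\hat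 A$. Nonresonance is assumed: for $\mathbf k\in\mathbb Z^m$, $\mathbf k\cdot\boldsymbol\mu=0 \bmod 2\pi i$ if and only if $\mathbf k=0$. Indices are ordered so that $\Re(\mu_j)>0$ for $1\le j\le l$, where $l\le m$; below $\boldsymbol\mu$ and $\mathbf a$ denote $(\mu_1,\dots,\mu_l)$ and $(a_1,\dots,a_l)$. Transseries and Borel sums. A transseries solution is a formal solution $$\tilde{\mathbf x}(t)=\sum_{\mathbf k\in\mathbb N^l}\mathbf C^{\mathbf k}e^{-\mathbf k\cdot\boldsymbol\mu t}t^{\mathbf k\cdot\mathbf a}\tilde{\mathbf x}_{\mathbf k}(t)$$ (with $t=n$), where $\mathbf C\in\mathbb C^l$ and the $\tilde{\mathbf x}_{\mathbf k}$ are formal power series in $t^{-1}$ with coefficients in $\mathbb C^m$. It is Borel summable (as $t\to+\infty$) if there are constants $A,\nu>0$, a sectorial neighborhood $\mathcal S$ of $\mathbb R^+$ (a set of the form $\{|p|<\epsilon\}\cup\{p:|\arg p|<\delta\}$ with $\epsilon,\delta>0$) and functions $\mathbf X_{\mathbf k}$ analytic in $\mathcal S$ with $$\sup_{p\in\mathcal S,\ \mathbf k\in\mathbb N^l}\big|A^{|\mathbf k|}e^{-\nu|p|}\mathbf X_{\mathbf k}(p)\big|<\infty,$$ such that the functions $\mathbf x_{\mathbf k}(t)=\int_0^\infty e^{-tp}\mathbf X_{\mathbf k}(p)\,dp$ satisfy $\mathbf x_{\mathbf k}(t)\sim\tilde{\mathbf x}_{\mathbf k}(t)$ as $t\to+\infty$.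 The number $t_0$ is taken large enough that the series $\sum_{\mathbf k}\mathbf C^{\mathbf k}e^{-\mathbf k\cdot\boldsymbol\mu t}t^{\mathbf k\cdot\mathbf a}\mathbf x_{\mathbf k}(t)$ converges in $\{t:\Re(t)>t_0\}$; its sum $\mathbf x(t)$ is the Borel sum of $\tilde{\mathbf x}$, and $\mathbf x(n)$ is a solution of the system for large $n$. *)

theory Defs
  imports "HOL-Complex_Analysis.Complex_Analysis" "HOL-Library.Landau_Symbols"
begin

unbundle no fps_syntax

text \<open>
  The dimension \<open>m\<close> is the cardinality of the finite index type \<open>'m\<close>. The distinguished indices
  \<open>1, \<dots>, l\<close> (for which \<open>\<Re>(\<mu>\<^sub>j) > 0\<close>) form a set \<open>L :: 'm set\<close>, and \<open>\<nat>\<^sup>l\<close> is the set of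
  multi-indices on \<open>'m\<close> that vanish outside \<open>L\<close>. Entries of \<open>C\<close> outside \<open>L\<close> are therefore never used.
\<close>

type_synonym 'm mindex = "'m \<Rightarrow> nat"

definition mindices :: "'m set \<Rightarrow> 'm mindex set" where
  "mindices L = {k. \<forall>j. j \<notin> L \<longrightarrow> k j = 0}"

definition mi_abs :: "'m::finite mindex \<Rightarrow> nat" where
  "mi_abs k = (\<Sum>j\<in>UNIV. k j)"

definition mi_power :: "complex ^ 'm::finite \<Rightarrow> 'm mindex \<Rightarrow> complex" where
  "mi_power x k = (\<Prod>j\<in>UNIV. (x $ j) ^ k j)"

definition mi_dot :: "'m::finite mindex \<Rightarrow> complex ^ 'm \<Rightarrow> complex" where
  "mi_dot k v = (\<Sum>j\<in>UNIV. of_nat (k j) * v $ j)"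


section \<open>The difference system\<close>

text \<open>Eigenvalues are listed with algebraic multiplicity.\<close>

definition lists_eigenvalues :: "complex ^ 'm ^ 'm::finite \<Rightarrow> ('m \<Rightarrow> complex) \<Rightarrow> bool" where
  "lists_eigenvalues M e \<longleftrightarrow> (\<forall>z. det (mat z - M) = (\<Prod>j\<in>UNIV. z - e j))"

lemma lists_eigenvalues_range:
  fixes M :: "complex ^ 'm ^ 'm::finite"
  assumes "lists_eigenvalues M e"
  shows "range e = {z. \<exists>v. v \<noteq> 0 \<and> M *v v = z *s v}"
proof -
  have "mat z *v v = z *s v" for z and v :: "complex ^ 'm"
    by (simp add: vec_eq_iff matrix_vector_mult_def mat_def if_distrib if_distribR sum.delta
        cong: if_cong)
  then have mat_vec: "(mat z - M) *v v = z *s v - M *v v" for z and v :: "complex ^ 'm"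
    by (simp only: matrix_vector_mult_diff_rdistrib)
  have "z \<in> range e \<longleftrightarrow> (\<exists>v. v \<noteq> 0 \<and> M *v v = z *s v)" for z
  proof -
    have "z \<in> range e \<longleftrightarrow> det (mat z - M) = 0"
      using assms by (auto simp: lists_eigenvalues_def)
    also have "\<dots> \<longleftrightarrow> \<not> (\<forall>v. (mat z - M) *v v = 0 \<longrightarrow> v = 0)"
      using invertible_det_nz[of "mat z - M"] invertible_left_inverse[of "mat z - M"]
        matrix_left_invertible_ker[of "mat z - M"] by simp
    also have "\<dots> \<longleftrightarrow> (\<exists>v. v \<noteq> 0 \<and> M *v v = z *s v)"
      unfolding mat_vec by (metis eq_iff_diff_eq_0)
    finally show ?thesis .
  qed
  then show ?thesis by blast
qed

definition nonresonant :: "complex ^ 'm::finite \<Rightarrow> bool" where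
  "nonresonant \<mu> \<longleftrightarrow>
     (\<forall>k :: 'm \<Rightarrow> int.
        (\<exists>q :: int. (\<Sum>j\<in>UNIV. of_int (k j) * \<mu> $ j) = 2 * of_real pi * \<i> * of_int q) \<longleftrightarrow>
        (\<forall>j. k j = 0))"

text \<open>
  A function is analytic at infinity if it is a convergent power series in \<open>1/z\<close> for large \<open>|z|\<close>.
  Its value at the point \<open>0 = 1/\<infinity>\<close> plays no role, which is why
  \<^const>\<open>has_fps_expansion\<close> does not apply directly to \<open>\<lambda>w. f (1/w)\<close>.
\<close>

definition has_expansion_at_infinity :: "(complex \<Rightarrow> complex) \<Rightarrow> complex fps \<Rightarrow> bool" where
  "has_expansion_at_infinity f F \<longleftrightarrow>
     fps_conv_radius F > 0 \<and> (\<forall>\<^sub>F z in at_infinity. f z = eval_fps F (inverse z))"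

definition analytic_at_infinity :: "(complex \<Rightarrow> complex) \<Rightarrow> bool" where
  "analytic_at_infinity f \<longleftrightarrow> (\<exists>F. has_expansion_at_infinity f F)"

definition expansion_at_infinity :: "(complex \<Rightarrow> complex) \<Rightarrow> complex fps" where
  "expansion_at_infinity f = (THE F. has_expansion_at_infinity f F)"

lemma has_expansion_at_infinity_unique:
  assumes F: "has_expansion_at_infinity f F" and G: "has_expansion_at_infinity f G"
  shows "F = G"
proof -
  have rF: "fps_conv_radius F > 0" and rG: "fps_conv_radius G > 0"
    using F G unfolding has_expansion_at_infinity_def by auto
  have "\<forall>\<^sub>F z in at_infinity. f z = eval_fps F (inverse z)"
       "\<forall>\<^sub>F z in at_infinity. f z = eval_fps G (inverse z)"
    using F G unfolding has_expansion_at_infinity_def by auto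
  then have "\<forall>\<^sub>F z in at_infinity. eval_fps F (inverse z) = eval_fps G (inverse z)"
    by (rule eventually_elim2) simp
  then have ev: "\<forall>\<^sub>F w in at 0. eval_fps F w = eval_fps G w"
    unfolding at_to_infinity eventually_filtermap .
  have expF: "eval_fps F has_fps_expansion F" and expG: "eval_fps G has_fps_expansion G"
    using rF rG by (simp_all add: eval_fps_has_fps_expansion)
  have "eval_fps F \<midarrow>0\<rightarrow> eval_fps F 0" "eval_fps G \<midarrow>0\<rightarrow> eval_fps G 0"
    using has_fps_expansion_imp_continuous[OF expF, of UNIV]
      has_fps_expansion_imp_continuous[OF expG, of UNIV]
    by (simp_all add: continuous_within)
  moreover from this(1) have "eval_fps G \<midarrow>0\<rightarrow> eval_fps F 0"
    using tendsto_cong[OF ev] by simp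
  ultimately have eq0: "eval_fps F 0 = eval_fps G 0"
    using LIM_unique by blast
  have "\<forall>\<^sub>F w in nhds 0. eval_fps F w = eval_fps G w"
    using ev unfolding eventually_at_filter by (rule eventually_mono) (use eq0 in auto)
  then have "eval_fps F has_fps_expansion G"
    using expG has_fps_expansion_cong[of "eval_fps F" "eval_fps G" G G] by simp
  with expF show ?thesis
    by (rule fps_expansion_unique_complex)
qed

lemma expansion_at_infinity_eq:
  assumes "has_expansion_at_infinity f F"
  shows "expansion_at_infinity f = F"
  unfolding expansion_at_infinity_def
proof (rule the_equality)
  show "has_expansion_at_infinity f F" by (fact assms)
  show "G = F" if "has_expansion_at_infinity f G" for G
    using that assms by (rule has_expansion_at_infinity_unique)
qed

definition admissible_nonlinearity ::
    "('m::finite mindex \<Rightarrow> complex \<Rightarrow> complex ^ 'm) \<Rightarrow> bool" where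
  "admissible_nonlinearity g \<longleftrightarrow>
     (\<exists>r>0. \<forall>\<^sub>F n in sequentially. \<forall>x. norm x < r \<longrightarrow>
        (\<lambda>k. mi_power x k *s g k (of_nat n)) summable_on UNIV) \<and>
     (\<forall>k i. analytic_at_infinity (\<lambda>z. g k z $ i)) \<and>
     (\<forall>k i. mi_abs k \<le> 1 \<longrightarrow> (\<lambda>z. g k z $ i) \<in> O[at_infinity](\<lambda>z. 1 / z ^ 2))"

definition solves_for_large_n ::
    "complex ^ 'm ^ 'm \<Rightarrow> complex ^ 'm ^ 'm \<Rightarrow> ('m::finite mindex \<Rightarrow> complex \<Rightarrow> complex ^ 'm) \<Rightarrow>
     (nat \<Rightarrow> complex ^ 'm) \<Rightarrow> bool" where
  "solves_for_large_n \<Lambda> A g x \<longleftrightarrow>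
     (\<forall>\<^sub>F n in sequentially.
        ((\<lambda>k. mi_power (x n) k *s g k (of_nat n)) has_sum
           (x (Suc n) - (\<Lambda> ** (mat 1 + (1 / real n) *\<^sub>R A)) *v x n)) UNIV)"


section \<open>Formal transseries solutions\<close>

text \<open>
  Formal power series in \<open>1/t\<close> are power series in the variable \<^const>\<open>fps_X\<close>, standing for \<open>1/t\<close>;
  vector-valued ones have type \<open>complex fps ^ 'm\<close>. A family \<open>y\<close> of such series represents the formal
  transseries \<open>\<Sum>\<^sub>k exp(-k\<cdot>\<mu> t) t\<^bsup>k\<cdot>a\<^esup> y\<^sub>k(t)\<close>.
\<close>

definition fps_matrix :: "complex ^ 'm ^ 'm \<Rightarrow> complex fps ^ 'm ^ 'm" where
  "fps_matrix M = (\<chi> i j. fps_const (M $ i $ j))"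

text \<open>
  Coefficient of \<open>exp(-k\<cdot>\<mu> t) t\<^bsup>k\<cdot>a\<^esup>\<close> in the transseries after \<open>t \<mapsto> t + 1\<close>: this is
  \<open>exp(-k\<cdot>\<mu>) (1 + 1/t)\<^bsup>k\<cdot>a\<^esup> y\<^sub>k(t + 1)\<close>, and \<open>1/(t+1) = (1/t) / (1 + 1/t)\<close>.
\<close>

definition ts_shift ::
    "complex ^ 'm \<Rightarrow> complex ^ 'm \<Rightarrow> ('m::finite mindex \<Rightarrow> complex fps ^ 'm) \<Rightarrow>
     'm mindex \<Rightarrow> complex fps ^ 'm" where
  "ts_shift \<mu> a y k =
     (\<chi> i. fps_const (exp (- mi_dot k \<mu>)) * fps_binomial (mi_dot k a) *
           ((y k $ i) oo (fps_X * inverse (1 + fps_X))))"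

text \<open>
  Coefficient of \<open>exp(-k\<cdot>\<mu> t) t\<^bsup>k\<cdot>a\<^esup>\<close> in the monomial \<open>\<Prod>\<^sub>i (y\<^sub>i)\<^bsup>j i\<^esup>\<close> of a transseries. The product has
  one factor for every \<open>(i, s)\<close> with \<open>s < j i\<close>, and one sums over all ways of distributing \<open>k\<close> over
  these factors.
\<close>

definition ts_monomial ::
    "('m::finite mindex \<Rightarrow> complex fps ^ 'm) \<Rightarrow> 'm mindex \<Rightarrow> 'm mindex \<Rightarrow> complex fps" where
  "ts_monomial y j k =
     (\<Sum>\<kappa> | \<kappa> \<in> (SIGMA i:UNIV. {..<j i}) \<rightarrow>\<^sub>E UNIV \<and>
            (\<forall>q. (\<Sum>p\<in>(SIGMA i:UNIV. {..<j i}). \<kappa> p q) = k q).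
        \<Prod>p\<in>(SIGMA i:UNIV. {..<j i}). y (\<kappa> p) $ fst p)"

text \<open>
  Substitution into the system and comparison of the coefficients of \<open>exp(-k\<cdot>\<mu> t) t\<^bsup>k\<cdot>a\<^esup>\<close>. These
  monomials are pairwise distinct for a nonresonant \<open>\<mu>\<close>. The sum over the terms of the nonlinearity
  is taken in the \<open>X\<close>-adic topology of the type of formal power series.
\<close>

definition formal_solution ::
    "complex ^ 'm ^ 'm \<Rightarrow> complex ^ 'm ^ 'm \<Rightarrow> ('m::finite mindex \<Rightarrow> complex \<Rightarrow> complex ^ 'm) \<Rightarrow>
     complex ^ 'm \<Rightarrow> complex ^ 'm \<Rightarrow> 'm set \<Rightarrow> ('m mindex \<Rightarrow> complex fps ^ 'm) \<Rightarrow> bool" where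
  "formal_solution \<Lambda> A g \<mu> a L y \<longleftrightarrow>
     (\<forall>k\<in>mindices L. \<forall>i.
        ((\<lambda>j. expansion_at_infinity (\<lambda>z. g j z $ i) * ts_monomial y j k) has_sum
           (ts_shift \<mu> a y k $ i -
            (fps_matrix \<Lambda> *v (y k + fps_X *s (fps_matrix A *v y k))) $ i)) UNIV)"

text \<open>The transseries \<open>\<Sum>\<^sub>k C\<^sup>k exp(-k\<cdot>\<mu> t) t\<^bsup>k\<cdot>a\<^esup> xt\<^sub>k(t)\<close>.\<close>

definition transseries_solution ::
    "complex ^ 'm ^ 'm \<Rightarrow> complex ^ 'm ^ 'm \<Rightarrow> ('m::finite mindex \<Rightarrow> complex \<Rightarrow> complex ^ 'm) \<Rightarrow>
     complex ^ 'm \<Rightarrow> complex ^ 'm \<Rightarrow> 'm set \<Rightarrow> complex ^ 'm \<Rightarrow>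
     ('m mindex \<Rightarrow> complex fps ^ 'm) \<Rightarrow> bool" where
  "transseries_solution \<Lambda> A g \<mu> a L C xt \<longleftrightarrow>
     formal_solution \<Lambda> A g \<mu> a L (\<lambda>k. fps_const (mi_power C k) *s xt k)"


section \<open>Borel summation\<close>

definition sectorial_nbhd :: "real \<Rightarrow> real \<Rightarrow> complex set" where
  "sectorial_nbhd \<epsilon> \<delta> = {p. norm p < \<epsilon>} \<union> {p. \<bar>Arg p\<bar> < \<delta>}"

definition laplace_integrand :: "(complex \<Rightarrow> complex ^ 'm::finite) \<Rightarrow> complex \<Rightarrow> real \<Rightarrow> complex ^ 'm"
  where "laplace_integrand Y t p = exp (- t * of_real p) *s Y (of_real p)"

definition laplace :: "(complex \<Rightarrow> complex ^ 'm::finite) \<Rightarrow> complex \<Rightarrow> complex ^ 'm" where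
  "laplace Y t = (LINT p:{0..}|lborel. laplace_integrand Y t p)"

text \<open>Poincare asymptotics \<open>f(t) \<sim> F\<close> as \<open>t \<rightarrow> +\<infinity>\<close> along the reals, \<open>F\<close> a formal series in \<open>1/t\<close>.\<close>

definition asymptotic_to :: "(complex \<Rightarrow> complex ^ 'm) \<Rightarrow> complex fps ^ 'm \<Rightarrow> bool" where
  "asymptotic_to f F \<longleftrightarrow>
     (\<forall>i N. (\<lambda>t::real. f (of_real t) $ i - (\<Sum>r<N. fps_nth (F $ i) r / of_real t ^ r))
              \<in> O[at_top](\<lambda>t. 1 / of_real t ^ N))"

text \<open>
  \<open>borel_transforms L xt X\<close>: the functions \<open>X\<^sub>k\<close> witness Borel summability of the family \<open>xt\<close>.
  They are determined by \<open>xt\<close>, since the asymptotic expansion of their Laplace transforms gives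
  their Taylor coefficients at \<open>0\<close>.
\<close>

definition borel_transforms ::
    "'m::finite set \<Rightarrow> ('m mindex \<Rightarrow> complex fps ^ 'm) \<Rightarrow>
     ('m mindex \<Rightarrow> complex \<Rightarrow> complex ^ 'm) \<Rightarrow> bool" where
  "borel_transforms L xt X \<longleftrightarrow>
     (\<exists>B>0. \<exists>\<nu>>0. \<exists>\<epsilon>>0. \<exists>\<delta>>0.
        (\<forall>k\<in>mindices L. \<forall>i. (\<lambda>p. X k p $ i) analytic_on sectorial_nbhd \<epsilon> \<delta>) \<and>
        (\<exists>K. \<forall>k\<in>mindices L. \<forall>p\<in>sectorial_nbhd \<epsilon> \<delta>.
           B ^ mi_abs k * exp (- \<nu> * norm p) * norm (X k p) \<le> K)) \<and>
     (\<forall>k\<in>mindices L. asymptotic_to (laplace (X k)) (xt k))"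

text \<open>\<open>t powr c\<close> is the principal branch.\<close>

definition borel_sum_term ::
    "complex ^ 'm \<Rightarrow> complex ^ 'm \<Rightarrow> complex ^ 'm \<Rightarrow>
     ('m::finite mindex \<Rightarrow> complex \<Rightarrow> complex ^ 'm) \<Rightarrow> complex \<Rightarrow> 'm mindex \<Rightarrow> complex ^ 'm" where
  "borel_sum_term \<mu> a C X t k =
     (mi_power C k * exp (- mi_dot k \<mu> * t) * t powr mi_dot k a) *s laplace (X k) t"

definition borel_sum_converges ::
    "complex ^ 'm \<Rightarrow> complex ^ 'm \<Rightarrow> 'm set \<Rightarrow> complex ^ 'm \<Rightarrow>
     ('m::finite mindex \<Rightarrow> complex \<Rightarrow> complex ^ 'm) \<Rightarrow> complex \<Rightarrow> bool" where
  "borel_sum_converges \<mu> a L C X t \<longleftrightarrow>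
     (\<forall>k\<in>mindices L. set_integrable lborel {0..} (laplace_integrand (X k) t)) \<and>
     borel_sum_term \<mu> a C X t summable_on mindices L"

definition borel_sum ::
    "complex ^ 'm \<Rightarrow> complex ^ 'm \<Rightarrow> 'm set \<Rightarrow> complex ^ 'm \<Rightarrow>
     ('m::finite mindex \<Rightarrow> complex \<Rightarrow> complex ^ 'm) \<Rightarrow> complex \<Rightarrow> complex ^ 'm" where
  "borel_sum \<mu> a L C X t = (\<Sum>\<^sub>\<infinity>k\<in>mindices L. borel_sum_term \<mu> a C X t k)"

end

(* Every term C^k e^{-k.mu n} n^{k.a} x_k(n) with C^k X_k not identically zero has, by Watson's lemma,
   exact size e^{-Re(k.mu) n} n^{Re(k.a) - r_k - 1}. Since Re(mu_j) > 0, only finitely many k attain the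
   minimal rate rho = Re(k.mu), and all other terms together are exponentially smaller. Dividing the
   vanishing sum by the dominant size e^{-rho n} n^sigma leaves a finite sum of z_k^n w_k(n) tending to 0,
   where the unimodular z_k = e^{-i Im(k.mu)} are distinct by nonresonance and the w_k vary slowly. Such
   a sum tends to 0 only if every w_k does, which contradicts the choice of sigma. So all terms with
   C^k nonzero have X_k = 0, and the Borel sum vanishes termwise. *)
theory Submission
  imports Defs "HOL-Real_Asymp.Real_Asymp"
begin

text \<open>The leading behaviour of a term is c z^n n^q exp(-rho n) with complex q. After
  normalisation a factor n^(i tau) can remain: it has modulus one and no limit, but oscillates ever
  more slowly. The coefficients therefore cannot be treated as convergent, and the only regularity
  kept is w(n+1) - w(n) -> 0. Since only integer n are observed, frequencies count modulo 2 pi,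
  which matches nonresonance modulo 2 pi i. The argument runs in one coordinate of C^m at a time:
  the coordinates of one X_k may vanish to different orders at 0, or identically, so the
  contributing set of k and the leading exponents both depend on the coordinate. Once X_k = 0 on the
  positive ray, its Laplace integral vanishes at every t, and this carries the conclusion from large
  integers to the whole half plane.\<close>

section \<open>Exponential sums with slowly varying coefficients\<close>

text \<open>One frequency \<open>z h\<close> is eliminated per induction step. What remains is a sum
  over the smaller set with coefficients (z k - z h) * w k, which are again slowly varying; the
  factors are nonzero by injectivity. Subtracting the other terms then recovers
  \<open>w h\<close>.\<close>

lemma tendsto_zero_of_exponential_sum:
  fixes z :: "'k \<Rightarrow> complex" and w :: "'k \<Rightarrow> nat \<Rightarrow> complex"
  assumes "finite G" "inj_on z G"
    and "\<And>k. k \<in> G \<Longrightarrow> norm (z k) = 1"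
    and "\<And>k. k \<in> G \<Longrightarrow> (\<lambda>n. w k (Suc n) - w k n) \<longlonglongrightarrow> 0"
    and "(\<lambda>n. \<Sum>k\<in>G. z k ^ n * w k n) \<longlonglongrightarrow> 0"
    and "k \<in> G"
  shows "w k \<longlonglongrightarrow> 0"
  using assms
proof (induction G arbitrary: w k rule: finite_induct)
  case empty
  then show ?case by simp
next
  case (insert h G)
  define s where "s = (\<lambda>n. \<Sum>k\<in>insert h G. z k ^ n * w k n)"
  have s: "s \<longlonglongrightarrow> 0"
    using insert.prems(4) by (simp add: s_def)
  have unit_cancel: "v \<longlonglongrightarrow> 0" if "(\<lambda>n. z k ^ n * v n) \<longlonglongrightarrow> 0" "k \<in> insert h G" for k v
    using tendsto_norm_zero[OF that(1)] insert.prems(2)[OF that(2)]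
    by - (rule tendsto_norm_zero_cancel, simp add: norm_mult norm_power)
  have unit_mult: "(\<lambda>n. z k ^ n * v n) \<longlonglongrightarrow> 0" if "v \<longlonglongrightarrow> 0" "k \<in> insert h G" for k v
    using tendsto_norm_zero[OF that(1)] insert.prems(2)[OF that(2)]
    by - (rule tendsto_norm_zero_cancel, simp add: norm_mult norm_power)
  \<comment> \<open>The operator s(n+1) - z h * s(n) would annihilate the h-term if
    \<open>w h\<close> were constant. The subtracted sum is the error of replacing each w k (n+1) by
    w k n, and it tends to 0.\<close>
  have "(\<lambda>n. s (Suc n) - z h * s n - (\<Sum>k\<in>insert h G. z k * (z k ^ n * (w k (Suc n) - w k n)))) \<longlonglongrightarrow>
      0 - z h * 0 - (\<Sum>k\<in>insert h G. z k * 0)"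
    by (intro tendsto_diff tendsto_mult tendsto_const tendsto_sum unit_mult s LIMSEQ_Suc[OF s] insert.prems(3))
  moreover have "s (Suc n) - z h * s n - (\<Sum>k\<in>insert h G. z k * (z k ^ n * (w k (Suc n) - w k n))) =
      (\<Sum>k\<in>G. z k ^ n * ((z k - z h) * w k n))" for n
  proof -
    have "s (Suc n) - z h * s n - (\<Sum>k\<in>insert h G. z k * (z k ^ n * (w k (Suc n) - w k n))) =
        (\<Sum>k\<in>insert h G. z k ^ n * ((z k - z h) * w k n))"
      unfolding s_def sum_distrib_left sum_subtractf[symmetric]
      by (intro sum.cong) (auto simp: algebra_simps)
    then show ?thesis
      using insert.hyps by simp
  qed
  ultimately have reduced: "(\<lambda>n. \<Sum>k\<in>G. z k ^ n * ((z k - z h) * w k n)) \<longlonglongrightarrow> 0"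
    by simp
  have wG: "w k \<longlonglongrightarrow> 0" if "k \<in> G" for k
  proof -
    have "(\<lambda>n. (z k - z h) * w k n) \<longlonglongrightarrow> 0"
    proof (rule insert.IH[OF _ _ _ reduced that])
      show "inj_on z G" using insert.prems(1) by simp
      show "norm (z k) = 1" if "k \<in> G" for k using insert.prems(2) that by simp
      show "(\<lambda>n. (z k - z h) * w k (Suc n) - (z k - z h) * w k n) \<longlonglongrightarrow> 0" if "k \<in> G" for k
        using tendsto_mult_right_zero[OF insert.prems(3)[of k], of "z k - z h"] that
        by (simp add: right_diff_distrib)
    qed
    then have "(\<lambda>n. inverse (z k - z h) * ((z k - z h) * w k n)) \<longlonglongrightarrow> 0"
      by (rule tendsto_mult_right_zero)
    moreover have "z k \<noteq> z h"
      using insert.prems(1) insert.hyps(2) that by (metis inj_onD insertCI)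
    ultimately show ?thesis
      by (simp add: mult.assoc[symmetric])
  qed
  have "(\<lambda>n. s n - (\<Sum>k\<in>G. z k ^ n * w k n)) \<longlonglongrightarrow> 0 - (\<Sum>k\<in>G. 0)"
    by (intro tendsto_diff s tendsto_sum unit_mult wG) simp_all
  then have "(\<lambda>n. z h ^ n * w h n) \<longlonglongrightarrow> 0"
    using insert.hyps by (simp add: s_def)
  then have "w h \<longlonglongrightarrow> 0"
    by (rule unit_cancel) simp
  with wG insert.prems(5) show ?case by auto
qed

text \<open>Here (n+1)^q = n^q exp(q (ln(n+1) - ln n)), and the exponential tends to 1. So the
  difference is n^q times a null sequence, and n^q is bounded because Re q is at most 0.\<close>

lemma powr_times_convergent_slowly_varying:
  fixes q d :: complex
  assumes q: "Re q \<le> 0" and u: "u \<longlonglongrightarrow> d"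
  shows "(\<lambda>n. of_nat (Suc n) powr q * u (Suc n) - of_nat n powr q * u n) \<longlonglongrightarrow> 0"
proof -
  define p where "p = (\<lambda>n::nat. of_nat n powr q)"
  have bound: "norm (p n) \<le> 1" for n
  proof (cases "n = 0")
    case False
    then have "norm (p n) = real n powr Re q"
      using norm_powr_real_powr[of "of_nat n" q] by (simp add: p_def)
    also have "\<dots> \<le> 1"
      using q False powr_mono[of "Re q" 0 "real n"] by simp
    finally show ?thesis .
  qed (simp add: p_def)
  have "(\<lambda>n. ln (real (Suc n)) - ln (real n)) \<longlonglongrightarrow> 0"
    by real_asymp
  then have "(\<lambda>n. exp (q * of_real (ln (real (Suc n)) - ln (real n))) * u (Suc n) - u n) \<longlonglongrightarrow>
      exp (q * of_real 0) * d - d"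
    by (intro tendsto_intros LIMSEQ_Suc u)
  then have lim: "(\<lambda>n. exp (q * of_real (ln (real (Suc n)) - ln (real n))) * u (Suc n) - u n) \<longlonglongrightarrow> 0"
    by simp
  have "(\<lambda>n. p n * (exp (q * of_real (ln (real (Suc n)) - ln (real n))) * u (Suc n) - u n)) \<longlonglongrightarrow> 0"
    by (rule Lim_null_comparison[OF _ tendsto_norm_zero[OF lim]])
      (use bound in \<open>auto simp: norm_mult intro!: mult_left_le_one_le always_eventually\<close>)
  moreover have "\<forall>\<^sub>F n in sequentially.
      p n * (exp (q * of_real (ln (real (Suc n)) - ln (real n))) * u (Suc n) - u n) =
      p (Suc n) * u (Suc n) - p n * u n"
    using eventually_gt_at_top[of 0]
  proof eventually_elim
    case (elim n)
    have "p n * exp (q * of_real (ln (real (Suc n)) - ln (real n))) = p (Suc n)"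
      using elim by (simp add: p_def powr_def exp_add[symmetric] Ln_of_nat algebra_simps of_real_diff del: of_nat_Suc)
    then show ?case by (simp add: algebra_simps)
  qed
  ultimately show ?thesis
    unfolding p_def by (rule Lim_transform_eventually)
qed

section \<open>Multi-indices\<close>

lemma Re_mi_dot:
  fixes v :: "complex ^ 'm::finite"
  shows "Re (mi_dot k v) = (\<Sum>j\<in>UNIV. real (k j) * Re (v $ j))"
  by (simp add: mi_dot_def)

lemma Re_mi_dot_ge:
  fixes \<mu> :: "complex ^ 'm::finite"
  assumes "k \<in> mindices L" "\<And>j. j \<in> L \<Longrightarrow> b \<le> Re (\<mu> $ j)"
  shows "b * mi_abs k \<le> Re (mi_dot k \<mu>)"
  unfolding Re_mi_dot mi_abs_def of_nat_sum sum_distrib_left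
proof (rule sum_mono)
  fix j
  show "b * real (k j) \<le> real (k j) * Re (\<mu> $ j)"
    using assms by (cases "j \<in> L") (auto simp: mindices_def mult.commute[of b] intro!: mult_left_mono)
qed

lemma Re_mi_dot_le:
  fixes a :: "complex ^ 'm::finite"
  assumes "\<And>j. Re (a $ j) \<le> b"
  shows "Re (mi_dot k a) \<le> b * mi_abs k"
  unfolding Re_mi_dot mi_abs_def of_nat_sum sum_distrib_left
  by (rule sum_mono) (use assms in \<open>auto simp: mult.commute[of b] intro!: mult_left_mono\<close>)

text \<open>All summands of Re(k.mu) are nonnegative, so each is at most R, which bounds
  \<open>k j\<close> for j in \<open>L\<close>. This is what makes a minimal rate exist and leaves a
  gap above it.\<close>

lemma finite_mindices_Re_mi_dot_le:
  fixes \<mu> :: "complex ^ 'm::finite"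
  assumes "\<forall>j\<in>L. 0 < Re (\<mu> $ j)"
  shows "finite {k \<in> mindices L. Re (mi_dot k \<mu>) \<le> R}"
proof (rule finite_subset)
  \<comment> \<open>The union gives all coordinates one common codomain. A coordinate outside
    \<open>L\<close> is 0, which lies in every one of the sets.\<close>
  show "{k \<in> mindices L. Re (mi_dot k \<mu>) \<le> R} \<subseteq> (UNIV \<rightarrow>\<^sub>E (\<Union>j. {..nat \<lceil>R / Re (\<mu> $ j)\<rceil>}))"
  proof (rule subsetI, rule PiE_I)
    fix k j
    assume "k \<in> {k \<in> mindices L. Re (mi_dot k \<mu>) \<le> R}"
    then have k: "k \<in> mindices L" "Re (mi_dot k \<mu>) \<le> R"
      by auto
    show "k j \<in> (\<Union>j. {..nat \<lceil>R / Re (\<mu> $ j)\<rceil>})"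
    proof (cases "j \<in> L")
      case True
      have "0 \<le> real (k i) * Re (\<mu> $ i)" for i
        using k(1) assms by (cases "i \<in> L") (auto simp: mindices_def less_imp_le)
      then have "real (k j) * Re (\<mu> $ j) \<le> Re (mi_dot k \<mu>)"
        unfolding Re_mi_dot by (intro member_le_sum) auto
      then have "real (k j) \<le> R / Re (\<mu> $ j)"
        using k(2) assms True by (simp add: field_simps)
      then show ?thesis
        by (intro UN_I[of j]) (auto simp: le_nat_iff le_ceiling_iff)
    next
      case False
      then show ?thesis using k(1) by (simp add: mindices_def)
    qed
  qed auto
qed (auto intro!: finite_PiE)

text \<open>A finite set of multi-indices lies in a box {0..N}^m, over which the sum factors into m
  geometric sums, each at most 2. This is the majorant for the tail of the transseries.\<close>

lemma summable_half_power_mi_abs: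
  "(\<lambda>k :: 'm::finite mindex. (1 / 2 :: real) ^ mi_abs k) summable_on S"
proof -
  have "(\<lambda>k :: 'm mindex. (1 / 2 :: real) ^ mi_abs k) summable_on UNIV"
  proof (intro nonneg_bdd_above_summable_on bdd_aboveI2)
    fix F :: "'m mindex set"
    assume "F \<in> {F. F \<subseteq> UNIV \<and> finite F}"
    then have F: "finite F" by simp
    define N where "N = (\<Sum>k\<in>F. mi_abs k)"
    have le_N: "k j \<le> N" if "k \<in> F" for k j
    proof -
      have "k j \<le> mi_abs k"
        unfolding mi_abs_def by (rule member_le_sum) auto
      also have "\<dots> \<le> N"
        unfolding N_def using F that by (intro member_le_sum) auto
      finally show ?thesis .
    qed
    have "(\<Sum>k\<in>F. (1 / 2 :: real) ^ mi_abs k) \<le> (\<Sum>k\<in>(UNIV :: 'm set) \<rightarrow>\<^sub>E {..N}. (1 / 2) ^ mi_abs k)"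
      by (intro sum_mono2 finite_PiE) (auto dest: le_N)
    also have "\<dots> = (\<Prod>j\<in>(UNIV :: 'm set). \<Sum>i\<le>N. (1 / 2) ^ i)"
      unfolding mi_abs_def power_sum by (rule prod_sum_PiE[symmetric]) auto
    also have "\<dots> \<le> (\<Prod>j\<in>(UNIV :: 'm set). 2)"
    proof (rule prod_mono)
      have "(\<Sum>i\<le>N. (1 / 2 :: real) ^ i) \<le> (\<Sum>i. (1 / 2) ^ i)"
        by (rule sum_le_suminf) (auto intro: summable_geometric)
      also have "\<dots> = 2"
        by (subst suminf_geometric) auto
      finally show "0 \<le> (\<Sum>i\<le>N. (1 / 2 :: real) ^ i) \<and> (\<Sum>i\<le>N. (1 / 2 :: real) ^ i) \<le> 2"
        by (simp add: sum_nonneg)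
    qed
    finally show "(\<Sum>k\<in>F. (1 / 2 :: real) ^ mi_abs k) \<le> (\<Prod>j\<in>(UNIV :: 'm set). 2)" .
  qed simp
  then show ?thesis
    by (rule summable_on_subset_banach) simp
qed

lemma norm_mi_power_le:
  fixes C :: "complex ^ 'm::finite"
  assumes "\<And>j. norm (C $ j) \<le> M"
  shows "norm (mi_power C k) \<le> M ^ mi_abs k"
proof -
  have "norm (mi_power C k) \<le> (\<Prod>j\<in>UNIV. M ^ k j)"
    unfolding mi_power_def prod_norm[symmetric]
    by (intro prod_mono) (auto simp: norm_power intro!: power_mono assms)
  then show ?thesis
    by (simp add: mi_abs_def power_sum)
qed

text \<open>The hypotheses say that (k - k').mu is an integer multiple of 2 pi i. The entries of k -
  k' may be negative, so nonresonance is applied to an integer vector.\<close>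

lemma nonresonant_exp_inj:
  fixes \<mu> :: "complex ^ 'm::finite"
  assumes "nonresonant \<mu>" "Re (mi_dot k \<mu>) = Re (mi_dot k' \<mu>)"
    and "exp (- \<i> * of_real (Im (mi_dot k \<mu>))) = exp (- \<i> * of_real (Im (mi_dot k' \<mu>)))"
  shows "k = k'"
proof -
  from assms(3) obtain q :: int where
    q: "- \<i> * of_real (Im (mi_dot k \<mu>)) = - \<i> * of_real (Im (mi_dot k' \<mu>)) + of_int (2 * q) * pi * \<i>"
    by (auto simp: exp_eq)
  then have im: "Im (mi_dot k \<mu>) = Im (mi_dot k' \<mu>) - 2 * q * pi"
    by (simp add: complex_eq_iff)
  define d where "d = (\<lambda>j. int (k j) - int (k' j))"
  have "(\<Sum>j\<in>UNIV. of_int (d j) * \<mu> $ j) = mi_dot k \<mu> - mi_dot k' \<mu>"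
    unfolding mi_dot_def sum_subtractf[symmetric] by (simp add: d_def algebra_simps)
  also have "\<dots> = 2 * of_real pi * \<i> * of_int (- q)"
    using im assms(2) by (simp add: complex_eq_iff)
  finally have "\<forall>j. d j = 0"
    using assms(1) unfolding nonresonant_def by blast
  then show ?thesis by (auto simp: d_def)
qed

section \<open>Laplace integrals\<close>

text \<open>These are the conditions under which a nonzero analytic function has a zero of finite
  order at 0. \<open>Arg\<close> is discontinuous on the negative axis, so the sector is cut along
  it: for \<delta> > pi the set is the whole plane, and otherwise the only point of the cut with
  argument below \<delta> is 0, which the disc covers. Connectedness holds because the set is
  starlike about 0.\<close>

lemma
  assumes "0 < \<delta>" "0 < \<epsilon>"
  shows open_sectorial_nbhd: "open (sectorial_nbhd \<epsilon> \<delta>)"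
    and connected_sectorial_nbhd: "connected (sectorial_nbhd \<epsilon> \<delta>)"
proof -
  have "open {p. \<bar>Arg p\<bar> < \<delta> \<and> p \<notin> \<real>\<^sub>\<le>\<^sub>0}"
  proof -
    have "open ((\<lambda>p. \<bar>Arg p\<bar>) -` {..<\<delta>} \<inter> - \<real>\<^sub>\<le>\<^sub>0)"
      using continuous_on_open_vimage[of "- \<real>\<^sub>\<le>\<^sub>0" "\<lambda>p. \<bar>Arg p\<bar>"]
      by (auto intro!: continuous_intros continuous_on_Arg simp: closed_nonpos_Reals_complex open_Compl)
    moreover have "((\<lambda>p. \<bar>Arg p\<bar>) -` {..<\<delta>} \<inter> - \<real>\<^sub>\<le>\<^sub>0) = {p. \<bar>Arg p\<bar> < \<delta> \<and> p \<notin> \<real>\<^sub>\<le>\<^sub>0}"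
      by auto
    ultimately show ?thesis by simp
  qed
  show "open (sectorial_nbhd \<epsilon> \<delta>)"
  proof (cases "\<delta> > pi")
    case True
    have "\<bar>Arg p\<bar> < \<delta>" for p
      using True mpi_less_Arg[of p] Arg_le_pi[of p] by linarith
    then have "sectorial_nbhd \<epsilon> \<delta> = UNIV"
      by (auto simp: sectorial_nbhd_def)
    then show ?thesis by simp
  next
    case False
    have "norm p < \<epsilon>" if "p \<in> \<real>\<^sub>\<le>\<^sub>0" "\<bar>Arg p\<bar> < \<delta>" for p
    proof -
      from that(1) obtain r where "p = of_real r" "r \<le> 0"
        by (auto elim: nonpos_Reals_cases)
      then show ?thesis using that(2) False assms by (cases "r < 0") auto
    qed
    then have "sectorial_nbhd \<epsilon> \<delta> = ball 0 \<epsilon> \<union> {p. \<bar>Arg p\<bar> < \<delta> \<and> p \<notin> \<real>\<^sub>\<le>\<^sub>0}"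
      using assms by (auto simp: sectorial_nbhd_def)
    then show ?thesis
      using \<open>open {p. \<bar>Arg p\<bar> < \<delta> \<and> p \<notin> \<real>\<^sub>\<le>\<^sub>0}\<close> by auto
  qed
  have "starlike (sectorial_nbhd \<epsilon> \<delta>)"
    unfolding starlike_def
  proof (intro bexI[of _ 0] ballI subsetI)
    fix p q assume p: "p \<in> sectorial_nbhd \<epsilon> \<delta>" and q: "q \<in> closed_segment 0 p"
    from q obtain u where u: "0 \<le> u" "u \<le> 1" "q = of_real u * p"
      by (auto simp: in_segment scaleR_conv_of_real)
    show "q \<in> sectorial_nbhd \<epsilon> \<delta>"
    proof (cases "u = 0")
      case True
      then show ?thesis using u assms by (simp add: sectorial_nbhd_def)
    next
      case False
      then have "Arg q = Arg p" using u by simp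
      moreover have "norm q \<le> norm p"
        using u by (simp add: norm_mult mult_left_le_one_le)
      ultimately show ?thesis using p by (auto simp: sectorial_nbhd_def)
    qed
  qed (use assms in \<open>simp add: sectorial_nbhd_def\<close>)
  then show "connected (sectorial_nbhd \<epsilon> \<delta>)"
    by (rule starlike_imp_connected)
qed

lemma nonneg_in_sectorial_nbhd:
  assumes "0 < \<delta>" "0 \<le> p"
  shows "of_real p \<in> sectorial_nbhd \<epsilon> \<delta>"
  using assms by (simp add: sectorial_nbhd_def)

section \<open>Gamma integrals and the leading asymptotics of Laplace integrals\<close>

lemma has_integral_power_times_exp:
  "((\<lambda>s::real. s ^ r * exp (- s)) has_integral fact r) {0..}"
proof -
  have "((\<lambda>s::real. s powr (real r) / exp s) has_integral fact r) {0..}"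
    using Gamma_integral_real[of "real r + 1"] Gamma_fact[of r, where ?'a = real] by (simp add: add.commute)
  \<comment> \<open>The integrands differ at s = 0 when r = 0: \<open>0 powr 0\<close> is 0 but
    \<open>0 ^ 0\<close> is 1.\<close>
  then show ?thesis
    by (rule has_integral_spike_finite[of "{0}", rotated 2])
      (auto simp: powr_realpow exp_minus divide_inverse)
qed

lemma set_integrable_power_times_exp:
  assumes b: "0 < b"
  shows "set_integrable lborel {0..} (\<lambda>s::real. s ^ r * exp (- b * s))"
proof -
  have "(\<lambda>s::real. s ^ r * exp (- s)) absolutely_integrable_on {0..}"
    by (rule nonnegative_absolutely_integrable_1)
      (use has_integral_power_times_exp[of r] in \<open>auto simp: integrable_on_def\<close>)
  then have "integrable lborel (\<lambda>s::real. indicator {0..} s *\<^sub>R (s ^ r * exp (- s)))"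
    unfolding set_integrable_def by (subst (asm) integrable_completion) auto
  from lborel_integrable_real_affine[OF this, of b 0]
  have "integrable lborel (\<lambda>s::real. (1 / b ^ r) * (indicator {0..} (b * s) *\<^sub>R ((b * s) ^ r * exp (- (b * s)))))"
    using b by (intro integrable_mult_right) simp
  also have "(\<lambda>s::real. (1 / b ^ r) * (indicator {0..} (b * s) *\<^sub>R ((b * s) ^ r * exp (- (b * s))))) =
      (\<lambda>s. indicator {0..} s *\<^sub>R (s ^ r * exp (- b * s)))"
    using b by (auto simp: fun_eq_iff power_mult_distrib zero_le_mult_iff split: split_indicator)
  finally show ?thesis
    by (simp add: set_integrable_def)
qed

text \<open>The substitution p = s / n turns the scaled integral into that of exp(-s) n^r f(s/n).
  Its pointwise limit is exp(-s) s^r c, and dominated convergence yields the Gamma integral r!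
  c.\<close>

lemma scaled_laplace_tendsto:
  fixes f :: "real \<Rightarrow> complex"
  assumes lim: "((\<lambda>s. f s / of_real s ^ r) \<longlongrightarrow> c) (at_right 0)"
    and cont: "continuous_on {0..} f"
    and bound: "\<And>s. 0 \<le> s \<Longrightarrow> norm (f s) \<le> M * s ^ r * exp (\<nu> * s)"
  shows "(\<lambda>n. of_nat n ^ Suc r * (LINT p:{0..}|lborel. exp (- of_nat n * of_real p) * f p))
    \<longlonglongrightarrow> fact r * c"
proof -
  define F where "F = (\<lambda>n s. indicator {0..} s *\<^sub>R
    (exp (- of_real s) * (of_nat n ^ r * f (s / real n))))"
  define F' where "F' = (\<lambda>s::real. indicator {0..} s *\<^sub>R (exp (- of_real s) * (of_real s ^ r * c)))"
  have int_F: "(LINT s|lborel. F n s) =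
      of_nat n ^ Suc r * (LINT p:{0..}|lborel. exp (- of_nat n * of_real p) * f p)"
    if "n > 0" for n :: nat
  proof -
    have "(LINT p:{0..}|lborel. exp (- of_nat n * of_real p) * f p) =
        (1 / real n) *\<^sub>R (LINT s|lborel. indicator {0..} (s / real n) *\<^sub>R
          (exp (- of_nat n * of_real (s / real n)) * f (s / real n)))"
      using that unfolding set_lebesgue_integral_def
      by (subst lborel_integral_real_affine[where c = "1 / real n" and t = 0]) auto
    also have "(LINT s|lborel. indicator {0..} (s / real n) *\<^sub>R
        (exp (- of_nat n * of_real (s / real n)) * f (s / real n))) =
        (LINT s|lborel. inverse (of_nat n ^ r) * F n s)"
      using that by (intro Bochner_Integration.integral_cong)
        (auto simp: F_def field_simps split: split_indicator)
    finally show ?thesis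
      using that by (simp add: scaleR_conv_of_real field_simps)
  qed
  \<comment> \<open>For n at least 2 |\<nu>| the growth exp(\<nu> s/n) costs at most exp(s/2), half
    of the decay exp(-s), so one majorant serves all n. The added 1 makes N positive, so the shifted
    index is never a zero divisor.\<close>
  obtain N where N: "2 * \<bar>\<nu>\<bar> + 1 \<le> real N"
    using real_arch_simple by blast
  then have "0 < N"
    by (cases N) auto
  have "(\<lambda>n. LINT s|lborel. F (n + N) s) \<longlonglongrightarrow> (LINT s|lborel. F' s)"
  proof (rule integral_dominated_convergence)
    show "integrable lborel (\<lambda>s. indicator {0..} s *\<^sub>R (\<bar>M\<bar> * (s ^ r * exp (- (1 / 2) * s))))"
      using set_integrable_mult_right[OF set_integrable_power_times_exp[of "1/2" r], of "\<bar>M\<bar>"]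
      by (simp add: set_integrable_def)
    show "F' \<in> borel_measurable lborel"
      unfolding F'_def by measurable
    show "F (n + N) \<in> borel_measurable lborel" for n
    proof -
      have "F (n + N) \<in> borel_measurable borel"
        unfolding F_def
        by (intro borel_measurable_continuous_on_indicator continuous_intros
            continuous_on_compose2[OF cont]) (use \<open>0 < N\<close> in auto)
      then show ?thesis by simp
    qed
    show "AE s in lborel. norm (F (n + N) s) \<le>
        indicator {0..} s *\<^sub>R (\<bar>M\<bar> * (s ^ r * exp (- (1 / 2) * s)))" for n
    proof (rule AE_I2)
      fix s :: real
      define n' where "n' = n + N"
      have n': "real n' > 0" "2 * \<bar>\<nu>\<bar> \<le> real n'"
        unfolding n'_def using N by auto
      show "norm (F (n + N) s) \<le> indicator {0..} s *\<^sub>R (\<bar>M\<bar> * (s ^ r * exp (- (1 / 2) * s)))"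
      proof (cases "0 \<le> s")
        case True
        have "\<nu> * (s / real n') \<le> s / 2"
        proof -
          have "\<nu> * s \<le> (real n' / 2) * s"
            using n' True by (intro mult_right_mono) auto
          then show ?thesis using n' by (simp add: field_simps)
        qed
        have "norm (F n' s) = exp (- s) * (real n' ^ r * norm (f (s / real n')))"
          using True by (simp add: F_def norm_mult norm_power)
        also have "\<dots> \<le> exp (- s) * (real n' ^ r * (\<bar>M\<bar> * (s / real n') ^ r * exp (s / 2)))"
        proof (intro mult_left_mono)
          have "norm (f (s / real n')) \<le> M * (s / real n') ^ r * exp (\<nu> * (s / real n'))"
            using True n' by (intro bound) auto
          also have "\<dots> \<le> \<bar>M\<bar> * (s / real n') ^ r * exp (s / 2)"
            using True n' \<open>\<nu> * (s / real n') \<le> s / 2\<close> by (intro mult_mono) auto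
          finally show "norm (f (s / real n')) \<le> \<bar>M\<bar> * (s / real n') ^ r * exp (s / 2)" .
        qed auto
        also have "\<dots> = \<bar>M\<bar> * (s ^ r * (exp (- s) * exp (s / 2)))"
          using n' by (simp add: power_divide)
        also have "exp (- s) * exp (s / 2) = exp (- (1 / 2) * s)"
          by (simp add: exp_add[symmetric])
        finally show ?thesis
          using True by (simp add: n'_def)
      qed (simp add: F_def)
    qed
    \<comment> \<open>The limit hypothesis is one-sided at 0 and says nothing about f(0), so the
      point s = 0 is discarded.\<close>
    have "AE s in lborel. s \<noteq> (0::real)"
      by (rule AE_lborel_singleton)
    then show "AE s in lborel. (\<lambda>n. F (n + N) s) \<longlonglongrightarrow> F' s"
    proof eventually_elim
      case (elim s)
      show ?case
      proof (cases "0 < s")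
        case True
        have "filterlim (\<lambda>n. s / real (n + N)) (at_right 0) sequentially"
          using True \<open>0 < N\<close>
          by (auto simp: filterlim_at intro!: always_eventually divide_pos_pos) real_asymp
        from filterlim_compose[OF lim this]
        have "(\<lambda>n. exp (- of_real s) * (of_real s ^ r * (f (s / real (n + N)) / of_real (s / real (n + N)) ^ r)))
            \<longlonglongrightarrow> exp (- of_real s) * (of_real s ^ r * c)"
          by (intro tendsto_intros)
        moreover have "exp (- of_real s) * (of_real s ^ r * (f (s / real (n + N)) / of_real (s / real (n + N)) ^ r)) =
            F (n + N) s" for n
          using True \<open>0 < N\<close> by (simp add: F_def power_divide field_simps del: of_nat_add)
        ultimately show ?thesis
          using True by (simp add: F'_def)
      qed (use elim in \<open>simp add: F_def F'_def\<close>)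
    qed
  qed
  also have "(LINT s|lborel. F' s) = fact r * c"
  proof -
    have "(LINT s|lborel. F' s) = (LINT s|lborel. of_real (indicator {0..} s *\<^sub>R (s ^ r * exp (- s))) * c)"
      by (intro Bochner_Integration.integral_cong)
        (auto simp: F'_def scaleR_conv_of_real exp_of_real[symmetric])
    also have "\<dots> = of_real (LINT s:{0..}|lborel. s ^ r * exp (- s)) * c"
      by (simp add: set_lebesgue_integral_def del: of_real_mult)
    also have "(LINT s:{0..}|lborel. s ^ r * exp (- s)) = (fact r :: real)"
      using set_borel_integral_eq_integral(2)[OF set_integrable_power_times_exp[of 1 r]]
        has_integral_power_times_exp[of r] by (simp add: integral_unique)
    finally show ?thesis by simp
  qed
  finally have "(\<lambda>n. LINT s|lborel. F n s) \<longlonglongrightarrow> fact r * c"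
    by (rule LIMSEQ_offset)
  then show ?thesis
    by (rule Lim_transform_eventually) (rule eventually_mono[OF eventually_gt_at_top[of 0]], rule int_F)
qed

text \<open>Watson's lemma, to leading order.\<close>

lemma scaled_laplace_tendsto_nonzero:
  fixes f :: "complex \<Rightarrow> complex"
  assumes pos: "0 < \<epsilon>" "0 < \<delta>" "0 \<le> \<nu>"
    and an: "f analytic_on sectorial_nbhd \<epsilon> \<delta>"
    and bound: "\<And>p. p \<in> sectorial_nbhd \<epsilon> \<delta> \<Longrightarrow> norm (f p) \<le> K * exp (\<nu> * norm p)"
    and nz: "\<exists>p\<in>sectorial_nbhd \<epsilon> \<delta>. f p \<noteq> 0"
  shows "\<exists>r c. c \<noteq> 0 \<and>
    (\<lambda>n. of_nat n ^ Suc r * (LINT p:{0..}|lborel. exp (- of_nat n * of_real p) * f (of_real p))) \<longlonglongrightarrow> c"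
proof -
  let ?S = "sectorial_nbhd \<epsilon> \<delta>"
  \<comment> \<open>Near 0, f(w) = w^r h(w) with h(0) nonzero; the limit will be r! h(0).\<close>
  define r where "r = nat (zorder f 0)"
  define h where "h = zor_poly f 0"
  have "0 \<in> ?S"
    using pos by (simp add: sectorial_nbhd_def)
  then obtain e where e: "0 < e" "h holomorphic_on cball 0 e"
    and fh: "\<And>w. w \<in> cball 0 e \<Longrightarrow> f w = h w * w ^ r \<and> h w \<noteq> 0"
    using zorder_exist_zero[OF analytic_imp_holomorphic[OF an]
        open_sectorial_nbhd[OF pos(2,1)] connected_sectorial_nbhd[OF pos(2,1)] _ nz, of 0]
    unfolding r_def h_def diff_zero by blast
  have cont_h: "continuous_on (cball 0 e) h"
    using e(2) by (rule holomorphic_on_imp_continuous_on)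
  obtain B where B: "\<And>w. w \<in> cball 0 e \<Longrightarrow> norm (h w) \<le> B"
    using compact_imp_bounded[OF compact_continuous_image[OF cont_h compact_cball]]
    unfolding bounded_iff by blast
  \<comment> \<open>On [0, e] compactness bounds |h| by B. Beyond e the factor s^r is at least e^r,
    so |K| / e^r turns the exponential bound into one that contains s^r.\<close>
  define M where "M = max B (\<bar>K\<bar> / e ^ r)"
  have "isCont h 0"
    using cont_h e(1) by (simp add: continuous_on_interior)
  then have "((\<lambda>s. h (of_real s)) \<longlongrightarrow> h (of_real 0)) (at_right 0)"
    by (intro isCont_tendsto_compose[where g = h] tendsto_intros) auto
  moreover have "\<forall>\<^sub>F s in at_right 0. h (of_real s) = f (of_real s) / of_real s ^ r"
    using eventually_at_right_real[OF e(1)]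
  proof eventually_elim
    case (elim s)
    then show ?case using fh[of "of_real s"] by simp
  qed
  ultimately have "((\<lambda>s. f (of_real s) / of_real s ^ r) \<longlongrightarrow> h 0) (at_right 0)"
    using Lim_transform_eventually by fastforce
  then have "(\<lambda>n. of_nat n ^ Suc r * (LINT p:{0..}|lborel. exp (- of_nat n * of_real p) * f (of_real p)))
    \<longlonglongrightarrow> fact r * h 0"
  proof (rule scaled_laplace_tendsto)
    show "continuous_on {0..} (\<lambda>s. f (of_real s))"
      using pos nonneg_in_sectorial_nbhd
      by (intro continuous_on_compose2[OF holomorphic_on_imp_continuous_on[OF analytic_imp_holomorphic[OF an]]]
          continuous_intros) auto
    fix s :: real assume s: "0 \<le> s"
    show "norm (f (of_real s)) \<le> M * s ^ r * exp (\<nu> * s)"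
    proof (cases "s \<le> e")
      case True
      have "norm (f (of_real s)) = norm (h (of_real s)) * s ^ r"
        using fh[of "of_real s"] s True by (simp add: norm_mult norm_power)
      also have "\<dots> \<le> M * s ^ r * 1"
        using B[of "of_real s"] s True by (auto simp: M_def intro!: mult_right_mono)
      also have "\<dots> \<le> M * s ^ r * exp (\<nu> * s)"
      proof (intro mult_left_mono mult_nonneg_nonneg)
        show "0 \<le> M"
          using e(1) by (simp add: M_def le_max_iff_disj)
      qed (use s pos in auto)
      finally show ?thesis .
    next
      case False
      have "norm (f (of_real s)) \<le> K * exp (\<nu> * s)"
        using bound[OF nonneg_in_sectorial_nbhd[OF pos(2) s]] s by simp
      also have "\<dots> \<le> \<bar>K\<bar> / e ^ r * e ^ r * exp (\<nu> * s)"
        using e(1) by (intro mult_right_mono) auto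
      also have "\<dots> \<le> M * s ^ r * exp (\<nu> * s)"
        using e(1) False s by (intro mult_right_mono mult_mono power_mono) (auto simp: M_def le_max_iff_disj)
      finally show ?thesis .
    qed
  qed
  moreover have "fact r * h 0 \<noteq> 0"
    using fh[of 0] e(1) by simp
  ultimately show ?thesis by blast
qed

section \<open>Vanishing transseries\<close>

lemma powr_times_exp_tendsto_0:
  fixes \<alpha> b :: real
  assumes "0 < b"
  shows "(\<lambda>n. real n powr \<alpha> * exp (- b * real n)) \<longlonglongrightarrow> 0"
  using assms by real_asymp

text \<open>The decay Re(k.mu) n is split in the proportion 1 - \<eta> to \<eta>. The first share
  yields a rate strictly above \<rho>. The second is at least \<eta> b |k| n and absorbs D^|k| and
  the power of n, whose exponent is at most \<alpha> |k|; a factor (1/2)^|k| is left for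
  summation.\<close>

lemma transseries_terms_tail_bound:
  fixes \<mu> a :: "complex ^ 'm::finite" and E :: "'m mindex \<Rightarrow> nat \<Rightarrow> complex"
  assumes pos: "\<forall>j\<in>L. 0 < Re (\<mu> $ j)"
    and J: "J \<subseteq> mindices L"
    and bound: "\<forall>\<^sub>F n in sequentially. \<forall>k\<in>J. norm (E k n) \<le> K * D ^ mi_abs k"
    and KD: "0 \<le> K" "0 \<le> D"
    and gap: "0 \<le> \<rho>" "\<rho> < \<rho>'" "\<And>k. k \<in> J \<Longrightarrow> \<rho>' \<le> Re (mi_dot k \<mu>)"
  shows "\<forall>\<^sub>F n in sequentially. \<forall>k\<in>J.
    norm (exp (- mi_dot k \<mu> * of_nat n) * of_nat n powr mi_dot k a * E k n)
      \<le> K * exp (- (\<rho> + \<rho>') / 2 * real n) * (1 / 2) ^ mi_abs k"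
proof -
  \<comment> \<open>Chosen so that (1 - \<eta>) \<rho>' is the midpoint of \<rho> and
    \<rho>'.\<close>
  define \<eta> where "\<eta> = (\<rho>' - \<rho>) / (2 * \<rho>')"
  have \<eta>: "0 < \<eta>" "\<eta> \<le> 1" "(1 - \<eta>) * \<rho>' = (\<rho> + \<rho>') / 2"
    using gap(1,2) by (auto simp: \<eta>_def field_simps)
  \<comment> \<open>Inserting 1 keeps the minimum meaningful and positive when \<open>L\<close> is
    empty.\<close>
  define b where "b = Min (insert 1 ((\<lambda>j. Re (\<mu> $ j)) ` L))"
  have "0 < b"
    unfolding b_def using pos by (subst Min_gr_iff) auto
  have b_le: "b \<le> Re (\<mu> $ j)" if "j \<in> L" for j
    unfolding b_def using that by (intro Min_le) auto
  define \<alpha> where "\<alpha> = Max (insert 0 (range (\<lambda>j. Re (a $ j))))"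
  have \<alpha>_ge: "Re (a $ j) \<le> \<alpha>" for j
    unfolding \<alpha>_def by (intro Max_ge) auto
  have "(\<lambda>n. D * (real n powr \<alpha> * exp (- (\<eta> * b) * real n))) \<longlonglongrightarrow> D * 0"
    by (intro tendsto_mult tendsto_const powr_times_exp_tendsto_0 mult_pos_pos \<eta>(1) \<open>0 < b\<close>)
  then have "\<forall>\<^sub>F n in sequentially. D * (real n powr \<alpha> * exp (- (\<eta> * b) * real n)) < 1 / 2"
    by (rule order_tendstoD) auto
  with bound eventually_gt_at_top[of 0] show ?thesis
  proof eventually_elim
    case (elim n)
    show ?case
    proof
      fix k assume k: "k \<in> J"
      let ?s = "mi_abs k"
      have R: "\<rho>' \<le> Re (mi_dot k \<mu>)" "b * ?s \<le> Re (mi_dot k \<mu>)"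
        using gap(3)[OF k] Re_mi_dot_ge[of k L b \<mu>] k J b_le by auto
      have "(\<rho> + \<rho>') / 2 + \<eta> * (b * ?s) \<le> (1 - \<eta>) * Re (mi_dot k \<mu>) + \<eta> * Re (mi_dot k \<mu>)"
        unfolding \<eta>(3)[symmetric] using \<eta> R by (intro add_mono mult_left_mono) auto
      also have "\<dots> = Re (mi_dot k \<mu>)"
        by (simp add: algebra_simps)
      finally have "((\<rho> + \<rho>') / 2 + \<eta> * (b * ?s)) * real n \<le> Re (mi_dot k \<mu>) * real n"
        by (intro mult_right_mono) auto
      then have "norm (exp (- mi_dot k \<mu> * of_nat n)) \<le>
          exp (- (\<rho> + \<rho>') / 2 * real n + real ?s * (- (\<eta> * b) * real n))"
        by (simp add: field_simps)
      also have "\<dots> = exp (- (\<rho> + \<rho>') / 2 * real n) * exp (- (\<eta> * b) * real n) ^ ?s"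
        by (simp only: exp_add exp_of_nat_mult)
      finally have 1: "norm (exp (- mi_dot k \<mu> * of_nat n)) \<le> \<dots>" .
      have "norm (of_nat n powr mi_dot k a :: complex) = real n powr Re (mi_dot k a)"
        using norm_powr_real_powr[of "of_nat n"] elim(2) by simp
      also have "\<dots> \<le> real n powr (\<alpha> * ?s)"
        using elim(2) Re_mi_dot_le[of a \<alpha> k] \<alpha>_ge by (intro powr_mono) auto
      also have "\<dots> = (real n powr \<alpha>) ^ ?s"
        using elim(2) by (simp add: powr_powr[symmetric] powr_realpow)
      finally have 2: "norm (of_nat n powr mi_dot k a :: complex) \<le> (real n powr \<alpha>) ^ ?s" .
      have "norm (exp (- mi_dot k \<mu> * of_nat n) * of_nat n powr mi_dot k a * E k n) \<le>
          (exp (- (\<rho> + \<rho>') / 2 * real n) * exp (- (\<eta> * b) * real n) ^ ?s) * (real n powr \<alpha>) ^ ?s * (K * D ^ ?s)"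
        unfolding norm_mult using 1 2 elim(1) k by (intro mult_mono) auto
      also have "\<dots> = K * exp (- (\<rho> + \<rho>') / 2 * real n) *
          (D * (real n powr \<alpha> * exp (- (\<eta> * b) * real n))) ^ ?s"
        by (simp add: power_mult_distrib)
      also have "\<dots> \<le> K * exp (- (\<rho> + \<rho>') / 2 * real n) * (1 / 2) ^ ?s"
        using elim(3) KD by (intro mult_left_mono power_mono) auto
      finally show "norm (exp (- mi_dot k \<mu> * of_nat n) * of_nat n powr mi_dot k a * E k n)
          \<le> K * exp (- (\<rho> + \<rho>') / 2 * real n) * (1 / 2) ^ ?s" .
    qed
  qed
qed

text \<open>The coefficients \<open>E\<close> abstract from Laplace integrals: what matters is a
  nonzero limit after scaling by a power of n, for each k separately, and a bound geometric in |k|,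
  uniform in n.\<close>

lemma no_leading_terms_if_transseries_sum_vanishes:
  fixes \<mu> a :: "complex ^ 'm::finite" and E :: "'m mindex \<Rightarrow> nat \<Rightarrow> complex"
  assumes nr: "nonresonant \<mu>"
    and pos: "\<forall>j\<in>L. 0 < Re (\<mu> $ j)"
    and J: "J \<subseteq> mindices L"
    and bound: "\<forall>\<^sub>F n in sequentially. \<forall>k\<in>J. norm (E k n) \<le> K * D ^ mi_abs k"
    and KD: "0 \<le> K" "0 \<le> D"
    and lead: "\<And>k. k \<in> J \<Longrightarrow> \<exists>r c. c \<noteq> 0 \<and> (\<lambda>n. of_nat n ^ Suc r * E k n) \<longlonglongrightarrow> c"
    and zero: "\<forall>\<^sub>F n in sequentially.
      (\<Sum>\<^sub>\<infinity>k\<in>J. exp (- mi_dot k \<mu> * of_nat n) * of_nat n powr mi_dot k a * E k n) = 0"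
  shows "J = {}"
proof (rule ccontr)
  assume "J \<noteq> {}"
  then obtain k1 where k1: "k1 \<in> J" by blast
  define T where "T = (\<lambda>n k. exp (- mi_dot k \<mu> * of_nat n) * of_nat n powr mi_dot k a * E k n)"
  have fin: "finite {k \<in> J. Re (mi_dot k \<mu>) \<le> R}" for R
    by (rule finite_subset[OF _ finite_mindices_Re_mi_dot_le[OF pos, of R]]) (use J in auto)

  \<comment> \<open>\<open>J\<close> may be infinite while \<open>Min\<close> needs a finite set, so
    the minimum is taken over the indices whose rate does not exceed that of
    \<open>k1\<close>.\<close>
  define \<rho> where "\<rho> = Min ((\<lambda>k. Re (mi_dot k \<mu>)) ` {k \<in> J. Re (mi_dot k \<mu>) \<le> Re (mi_dot k1 \<mu>)})"
  have "\<rho> \<in> (\<lambda>k. Re (mi_dot k \<mu>)) ` {k \<in> J. Re (mi_dot k \<mu>) \<le> Re (mi_dot k1 \<mu>)}"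
    unfolding \<rho>_def using fin k1 by (intro Min_in finite_imageI) auto
  then obtain k2 where k2: "k2 \<in> J" "Re (mi_dot k2 \<mu>) = \<rho>"
    by auto
  have \<rho>_le: "\<rho> \<le> Re (mi_dot k \<mu>)" if "k \<in> J" for k
  proof (cases "Re (mi_dot k \<mu>) \<le> Re (mi_dot k1 \<mu>)")
    case True
    then show ?thesis
      unfolding \<rho>_def using fin that by (intro Min_le finite_imageI) auto
  next
    case False
    moreover have "\<rho> \<le> Re (mi_dot k1 \<mu>)"
      unfolding \<rho>_def using fin k1 by (intro Min_le finite_imageI) auto
    ultimately show ?thesis by simp
  qed
  have "0 \<le> \<rho>"
    using Re_mi_dot_ge[of k2 L 0 \<mu>] k2 J pos by (auto simp: less_imp_le)
  define G where "G = {k \<in> J. Re (mi_dot k \<mu>) = \<rho>}"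
  have G: "finite G" "k2 \<in> G" "G \<subseteq> J"
    using k2 by (auto simp: G_def intro: finite_subset[OF _ fin[of \<rho>]])
  \<comment> \<open>The next larger rate, capped at \<rho> + 1. The cap keeps the set finite and
    covers the case that no index outside \<open>G\<close> remains below it.\<close>
  define \<rho>' where "\<rho>' = Min (insert (\<rho> + 1) ((\<lambda>k. Re (mi_dot k \<mu>)) ` {k \<in> J - G. Re (mi_dot k \<mu>) \<le> \<rho> + 1}))"
  have fin': "finite {k \<in> J - G. Re (mi_dot k \<mu>) \<le> \<rho> + 1}"
    by (rule finite_subset[OF _ fin[of "\<rho> + 1"]]) auto
  have "\<rho> < \<rho>'"
    unfolding \<rho>'_def using fin' \<rho>_le by (subst Min_gr_iff) (fastforce simp: G_def)+
  have \<rho>'_le: "\<rho>' \<le> Re (mi_dot k \<mu>)" if "k \<in> J - G" for k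
  proof (cases "Re (mi_dot k \<mu>) \<le> \<rho> + 1")
    case True
    then show ?thesis
      unfolding \<rho>'_def using fin' that by (intro Min_le) auto
  next
    case False
    moreover have "\<rho>' \<le> \<rho> + 1"
      unfolding \<rho>'_def using fin' by (intro Min_le) auto
    ultimately show ?thesis by simp
  qed

  obtain r c where rc: "\<And>k. k \<in> J \<Longrightarrow> c k \<noteq> 0"
      "\<And>k. k \<in> J \<Longrightarrow> (\<lambda>n. of_nat n ^ Suc (r k) * E k n) \<longlonglongrightarrow> c k"
    using lead by metis
  \<comment> \<open>Since E k n behaves like c k / n^(r k + 1), this is the largest real exponent of
    n among the terms of minimal rate.\<close>
  define \<sigma> where "\<sigma> = Max ((\<lambda>k. Re (mi_dot k a) - real (Suc (r k))) ` G)"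
  have \<sigma>_ge: "Re (mi_dot k a) - real (Suc (r k)) \<le> \<sigma>" if "k \<in> G" for k
    unfolding \<sigma>_def using G that by (intro Max_ge) auto
  have "\<sigma> \<in> (\<lambda>k. Re (mi_dot k a) - real (Suc (r k))) ` G"
    unfolding \<sigma>_def using G by (intro Max_in) auto
  then obtain h where h: "h \<in> G" "Re (mi_dot h a) - real (Suc (r h)) = \<sigma>"
    by auto

  \<comment> \<open>The exponent left after division by n^\<sigma>: Re (q k) is at most 0 on
    \<open>G\<close>, with equality at \<open>h\<close>. Its imaginary part can survive, so
    \<open>w k\<close> is slowly varying and need not converge.\<close>
  define q where "q = (\<lambda>k. mi_dot k a - of_real \<sigma> - of_nat (Suc (r k)))"
  define u where "u = (\<lambda>k n. of_nat n ^ Suc (r k) * E k n)"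
  define w where "w = (\<lambda>k n. of_nat n powr q k * u k n)"
  define z where "z = (\<lambda>k. exp (- \<i> * of_real (Im (mi_dot k \<mu>))))"
  define s where "s = (\<lambda>n. exp (of_real (\<rho> * real n)) * of_nat n powr (- of_real \<sigma>) :: complex)"
  have s_T: "s n * T n k = z k ^ n * w k n" if "k \<in> G" "n > 0" for k n
  proof -
    have "of_real (\<rho> * real n) + - mi_dot k \<mu> * of_nat n =
        of_nat n * (- \<i> * of_real (Im (mi_dot k \<mu>)))"
      using that by (simp add: G_def complex_eq_iff)
    then have "exp (of_real (\<rho> * real n)) * exp (- mi_dot k \<mu> * of_nat n) =
        exp (of_nat n * (- \<i> * of_real (Im (mi_dot k \<mu>))))"
      by (simp only: exp_add[symmetric])
    also have "\<dots> = z k ^ n"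
      unfolding z_def exp_of_nat_mult by simp
    finally have 1: "exp (of_real (\<rho> * real n)) * exp (- mi_dot k \<mu> * of_nat n) = z k ^ n" .
    have "(of_nat n :: complex) powr (- of_real \<sigma>) * of_nat n powr mi_dot k a = of_nat n powr (q k + of_nat (Suc (r k)))"
      unfolding powr_add[symmetric] by (simp add: q_def)
    also have "\<dots> = of_nat n powr q k * of_nat n ^ Suc (r k)"
      unfolding powr_add by (subst powr_nat') simp_all
    finally have 2: "(of_nat n :: complex) powr (- of_real \<sigma>) * of_nat n powr mi_dot k a = \<dots>" .
    have "s n * T n k = (exp (of_real (\<rho> * real n)) * exp (- mi_dot k \<mu> * of_nat n)) *
        (of_nat n powr (- of_real \<sigma>) * of_nat n powr mi_dot k a) * E k n"
      by (simp add: s_def T_def mult_ac)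
    then show ?thesis
      unfolding 1 2 by (simp add: w_def u_def mult_ac)
  qed

  define W where "W = (\<Sum>\<^sub>\<infinity>k\<in>J - G. (1 / 2 :: real) ^ mi_abs k)"
  have "\<forall>\<^sub>F n in sequentially. \<forall>k\<in>J - G. norm (T n k) \<le> K * exp (- (\<rho> + \<rho>') / 2 * real n) * (1 / 2) ^ mi_abs k"
    unfolding T_def
    by (rule transseries_terms_tail_bound[OF pos _ _ KD \<open>0 \<le> \<rho>\<close> \<open>\<rho> < \<rho>'\<close> \<rho>'_le])
      (use J bound in \<open>auto elim: eventually_mono\<close>)
  then have "\<forall>\<^sub>F n in sequentially. norm (\<Sum>k\<in>G. z k ^ n * w k n) \<le>
      real n powr (- \<sigma>) * exp (- ((\<rho>' - \<rho>) / 2) * real n) * (K * W)"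
    using zero eventually_gt_at_top[of 0]
  proof eventually_elim
    case (elim n)
    let ?B = "\<lambda>k. K * exp (- (\<rho> + \<rho>') / 2 * real n) * (1 / 2) ^ mi_abs k"
    have B: "?B summable_on (J - G)"
      by (intro summable_on_cmult_right summable_half_power_mi_abs)
    have abs: "(\<lambda>k. norm (T n k)) summable_on (J - G)"
      by (rule summable_on_comparison_test[OF B]) (use elim(1) in auto)
    \<comment> \<open>Summability has to be secured before the sum is split, because
      \<open>infsum\<close> of a non-summable family is 0 by convention and its vanishing alone
      would carry no information.\<close>
    then have "T n summable_on (J - G)"
      by (rule abs_summable_summable)
    then have "infsum (T n) (G \<union> (J - G)) = infsum (T n) G + infsum (T n) (J - G)"
      using G by (intro infsum_Un_disjoint) auto
    moreover have "G \<union> (J - G) = J"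
      using G by auto
    ultimately have "sum (T n) G = - infsum (T n) (J - G)"
      using elim(2) G by (simp add: T_def eq_neg_iff_add_eq_0)
    then have "norm (sum (T n) G) \<le> (\<Sum>\<^sub>\<infinity>k\<in>J - G. norm (T n k))"
      using norm_infsum_bound[OF abs] by simp
    also have "\<dots> \<le> infsum ?B (J - G)"
      using elim(1) by (intro infsum_mono abs B) auto
    also have "\<dots> = K * exp (- (\<rho> + \<rho>') / 2 * real n) * W"
      unfolding W_def by (rule infsum_cmult_right')
    finally have sum_le: "norm (sum (T n) G) \<le> K * exp (- (\<rho> + \<rho>') / 2 * real n) * W" .
    have "(\<Sum>k\<in>G. z k ^ n * w k n) = s n * sum (T n) G"
      unfolding sum_distrib_left using s_T elim(3) by (intro sum.cong) auto
    then have "norm (\<Sum>k\<in>G. z k ^ n * w k n) = norm (s n) * norm (sum (T n) G)"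
      by (simp add: norm_mult)
    also have "norm (s n) = exp (\<rho> * real n) * real n powr (- \<sigma>)"
      using norm_powr_real_powr[of "of_nat n" "- of_real \<sigma>"] elim(3) by (simp add: s_def norm_mult)
    also have "exp (\<rho> * real n) * real n powr (- \<sigma>) * norm (sum (T n) G) \<le>
        exp (\<rho> * real n) * real n powr (- \<sigma>) * (K * exp (- (\<rho> + \<rho>') / 2 * real n) * W)"
      by (intro mult_left_mono sum_le) auto
    also have "\<dots> = real n powr (- \<sigma>) * (exp (\<rho> * real n) * exp (- (\<rho> + \<rho>') / 2 * real n)) * (K * W)"
      by (simp add: mult_ac)
    also have "exp (\<rho> * real n) * exp (- (\<rho> + \<rho>') / 2 * real n) = exp (- ((\<rho>' - \<rho>) / 2) * real n)"
      by (simp add: exp_add[symmetric] field_simps)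
    finally show ?case .
  qed
  moreover have "(\<lambda>n. real n powr (- \<sigma>) * exp (- ((\<rho>' - \<rho>) / 2) * real n) * (K * W)) \<longlonglongrightarrow> 0"
    using \<open>\<rho> < \<rho>'\<close> by (intro tendsto_mult_left_zero powr_times_exp_tendsto_0) simp
  ultimately have lim: "(\<lambda>n. \<Sum>k\<in>G. z k ^ n * w k n) \<longlonglongrightarrow> 0"
    by (rule Lim_null_comparison)

  have "w h \<longlonglongrightarrow> 0"
  proof (rule tendsto_zero_of_exponential_sum[OF G(1) _ _ _ lim h(1)])
    show "inj_on z G"
      unfolding z_def by (rule inj_onI) (auto simp: G_def intro: nonresonant_exp_inj[OF nr])
    show "norm (z k) = 1" if "k \<in> G" for k
      by (simp add: z_def)
    show "(\<lambda>n. w k (Suc n) - w k n) \<longlonglongrightarrow> 0" if "k \<in> G" for k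
      unfolding w_def
    proof (rule powr_times_convergent_slowly_varying)
      show "Re (q k) \<le> 0"
        using \<sigma>_ge[OF that] by (simp add: q_def)
      show "u k \<longlonglongrightarrow> c k"
        unfolding u_def using rc(2) G that by blast
    qed
  qed
  then have "(\<lambda>n. norm (w h n)) \<longlonglongrightarrow> 0"
    by (rule tendsto_norm_zero)
  \<comment> \<open>At the maximiser \<open>h\<close> the power of n has modulus 1, so the null
    sequence \<open>w h\<close> would force the nonzero limit \<open>c h\<close> to vanish.\<close>
  moreover have "\<forall>\<^sub>F n in sequentially. norm (w h n) = norm (u h n)"
    using eventually_gt_at_top[of 0]
  proof eventually_elim
    case (elim n)
    have "Re (q h) = 0"
      using h(2) by (simp add: q_def)
    then show ?case
      using norm_powr_real_powr[of "of_nat n" "q h"] elim by (simp add: w_def norm_mult)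
  qed
  ultimately have "(\<lambda>n. norm (u h n)) \<longlonglongrightarrow> 0"
    by (rule Lim_transform_eventually)
  moreover have "(\<lambda>n. norm (u h n)) \<longlonglongrightarrow> norm (c h)"
    unfolding u_def using rc(2) h(1) G by (intro tendsto_norm) blast
  ultimately have "norm (c h) = 0"
    using LIMSEQ_unique by blast
  then show False
    using rc(1) h(1) G by auto
qed

section \<open>Scalar components of Laplace integrals and of the Borel sum\<close>

text \<open>A coordinate projection is bounded linear and commutes with the integral of an
  integrable function. Without integrability the vector integral is 0 by convention, even where one
  component has a nonzero integral.\<close>

lemma
  fixes Y :: "complex \<Rightarrow> complex ^ 'm::finite"
  assumes "set_integrable lborel {0..} (laplace_integrand Y t)"
  shows set_integrable_laplace_component:
      "set_integrable lborel {0..} (\<lambda>p. exp (- t * of_real p) * Y (of_real p) $ i)"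
    and laplace_component:
      "laplace Y t $ i = (LINT p:{0..}|lborel. exp (- t * of_real p) * Y (of_real p) $ i)"
proof -
  have int: "integrable lborel (\<lambda>p. indicator {0..} p *\<^sub>R laplace_integrand Y t p)"
    using assms by (simp add: set_integrable_def)
  have eq: "(indicator {0..} p *\<^sub>R laplace_integrand Y t p) $ i =
      indicator {0..} p *\<^sub>R (exp (- t * of_real p) * Y (of_real p) $ i)" for p
    by (simp add: laplace_integrand_def)
  show "set_integrable lborel {0..} (\<lambda>p. exp (- t * of_real p) * Y (of_real p) $ i)"
    using integrable_bounded_linear[OF bounded_linear_vec_nth int, of i]
    unfolding set_integrable_def eq .
  show "laplace Y t $ i = (LINT p:{0..}|lborel. exp (- t * of_real p) * Y (of_real p) $ i)"
    using integral_bounded_linear[OF bounded_linear_vec_nth int, of i]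
    unfolding laplace_def set_lebesgue_integral_def eq by simp
qed

text \<open>The margin 1 above \<nu> leaves the integrand below K exp(-p), whose integral is K. The
  bound is thus uniform in t, and its dependence on k enters only through K.\<close>

lemma norm_laplace_integral_le:
  fixes f :: "real \<Rightarrow> complex"
  assumes int: "set_integrable lborel {0..} (\<lambda>p. exp (- t * of_real p) * f p)"
    and bound: "\<And>p. 0 \<le> p \<Longrightarrow> norm (f p) \<le> K * exp (\<nu> * p)"
    and t: "\<nu> + 1 \<le> Re t"
  shows "norm (LINT p:{0..}|lborel. exp (- t * of_real p) * f p) \<le> K"
proof -
  have "0 \<le> K"
    using order_trans[OF norm_ge_zero bound[of 0]] by simp
  have exp_int: "set_integrable lborel {0..} (\<lambda>p::real. exp (- p))"
    using set_integrable_power_times_exp[of 1 0] by simp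
  have "norm (LINT p:{0..}|lborel. exp (- t * of_real p) * f p) \<le> (LINT p:{0..}|lborel. K * exp (- p))"
    unfolding set_lebesgue_integral_def
  proof (rule Bochner_Integration.integral_norm_bound_integral)
    show "integrable lborel (\<lambda>p. indicator {0..} p *\<^sub>R (exp (- t * of_real p) * f p))"
      using int by (simp add: set_integrable_def)
    show "integrable lborel (\<lambda>p. indicator {0..} p *\<^sub>R (K * exp (- p)))"
      using set_integrable_mult_right[OF exp_int, of K] by (simp add: set_integrable_def)
    fix p :: real
    show "norm (indicator {0..} p *\<^sub>R (exp (- t * of_real p) * f p)) \<le> indicator {0..} p *\<^sub>R (K * exp (- p))"
    proof (cases "0 \<le> p")
      case True
      have "norm (exp (- t * of_real p) * f p) \<le> exp (- Re t * p) * (K * exp (\<nu> * p))"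
        using bound[OF True] by (simp add: norm_mult)
      also have "\<dots> = K * exp (\<nu> * p - Re t * p)"
        by (simp add: exp_diff exp_minus field_simps)
      also have "\<dots> \<le> K * exp (- p)"
        using mult_right_mono[OF t True] \<open>0 \<le> K\<close> by (intro mult_left_mono) (auto simp: algebra_simps)
      finally show ?thesis using True by simp
    qed simp
  qed
  also have "\<dots> = K * (LINT p:{0..}|lborel. exp (- p))"
    by simp
  also have "(LINT p:{0..}|lborel. exp (- p)) = (1 :: real)"
    using set_borel_integral_eq_integral(2)[OF exp_int] has_integral_power_times_exp[of 0]
    by (simp add: integral_unique)
  finally show ?thesis by simp
qed

lemma borel_transform_component_eq_0:
  fixes \<mu> a C :: "complex ^ 'm::finite" and X :: "'m mindex \<Rightarrow> complex \<Rightarrow> complex ^ 'm"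
  assumes nr: "nonresonant \<mu>"
    and pos: "\<forall>j\<in>L. 0 < Re (\<mu> $ j)"
    and par: "0 < B" "0 < \<nu>" "0 < \<epsilon>" "0 < \<delta>"
    and an: "\<forall>k\<in>mindices L. (\<lambda>p. X k p $ i) analytic_on sectorial_nbhd \<epsilon> \<delta>"
    and bound: "\<forall>k\<in>mindices L. \<forall>p\<in>sectorial_nbhd \<epsilon> \<delta>.
      B ^ mi_abs k * exp (- \<nu> * norm p) * norm (X k p) \<le> K"
    and conv: "\<forall>\<^sub>F n in sequentially. borel_sum_converges \<mu> a L C X (of_nat n)"
    and zero: "\<forall>\<^sub>F n in sequentially. borel_sum \<mu> a L C X (of_nat n) = 0"
    and k: "k \<in> mindices L" "mi_power C k \<noteq> 0" "p \<in> sectorial_nbhd \<epsilon> \<delta>"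
  shows "X k p $ i = 0"
proof -
  let ?S = "sectorial_nbhd \<epsilon> \<delta>"
  \<comment> \<open>The indices that contribute to component i. A nonzero value anywhere in the
    sector suffices, as it makes the order of the zero at 0 finite.\<close>
  define J where "J = {k \<in> mindices L. mi_power C k \<noteq> 0 \<and> (\<exists>p\<in>?S. X k p $ i \<noteq> 0)}"
  define I where "I = (\<lambda>k n. LINT p:{0..}|lborel. exp (- of_nat n * of_real p) * X k (of_real p) $ i)"
  have X_le: "norm (X k p $ i) \<le> \<bar>K\<bar> / B ^ mi_abs k * exp (\<nu> * norm p)" if "k \<in> mindices L" "p \<in> ?S" for k p
  proof -
    have "norm (X k p) \<le> K / B ^ mi_abs k * exp (\<nu> * norm p)"
      using bound that par(1) by (simp add: exp_minus field_simps)
    also have "\<dots> \<le> \<bar>K\<bar> / B ^ mi_abs k * exp (\<nu> * norm p)"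
      using par(1) by (intro mult_right_mono divide_right_mono) auto
    finally show ?thesis
      using Finite_Cartesian_Product.norm_nth_le[of "X k p" i] by linarith
  qed
  \<comment> \<open>The base norm C / B combines |C^k| <= (norm C)^|k| with the factor B^(-|k|) from
    the uniform bound on the X_k.\<close>
  have "J = {}"
  proof (rule no_leading_terms_if_transseries_sum_vanishes[OF nr pos, where
        E = "\<lambda>k n. mi_power C k * I k n" and K = "\<bar>K\<bar>" and D = "norm C / B" and a = a])
    show "J \<subseteq> mindices L" by (auto simp: J_def)
    show "0 \<le> norm C / B" using par by simp
    show "\<exists>r c. c \<noteq> 0 \<and> (\<lambda>n. of_nat n ^ Suc r * (mi_power C k * I k n)) \<longlonglongrightarrow> c" if "k \<in> J" for k
    proof -
      have "\<exists>r c. c \<noteq> 0 \<and> (\<lambda>n. of_nat n ^ Suc r * I k n) \<longlonglongrightarrow> c"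
        unfolding I_def
      proof (rule scaled_laplace_tendsto_nonzero[OF par(3,4)])
        show "0 \<le> \<nu>" using par by simp
        show "norm (X k p $ i) \<le> \<bar>K\<bar> / B ^ mi_abs k * exp (\<nu> * norm p)" if "p \<in> ?S" for p
          using X_le that \<open>k \<in> J\<close> by (simp add: J_def)
      qed (use that an in \<open>auto simp: J_def\<close>)
      then obtain r c where "c \<noteq> 0" "(\<lambda>n. of_nat n ^ Suc r * I k n) \<longlonglongrightarrow> c" by blast
      then have "mi_power C k * c \<noteq> 0"
          "(\<lambda>n. mi_power C k * (of_nat n ^ Suc r * I k n)) \<longlonglongrightarrow> mi_power C k * c"
        using that by (auto simp: J_def intro: tendsto_mult_left)
      then have "mi_power C k * c \<noteq> 0"
          "(\<lambda>n. of_nat n ^ Suc r * (mi_power C k * I k n)) \<longlonglongrightarrow> mi_power C k * c"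
        by (simp_all only: mult.left_commute simp_thms)
      then show ?thesis by blast
    qed
    have "\<forall>\<^sub>F n in sequentially. \<nu> + 1 \<le> real n"
      by real_asymp
    with conv show "\<forall>\<^sub>F n in sequentially. \<forall>k\<in>J. norm (mi_power C k * I k n) \<le> \<bar>K\<bar> * (norm C / B) ^ mi_abs k"
    proof eventually_elim
      case (elim n)
      show ?case
      proof
        fix k assume "k \<in> J"
        then have k: "k \<in> mindices L" by (simp add: J_def)
        have "norm (I k n) \<le> \<bar>K\<bar> / B ^ mi_abs k"
          unfolding I_def
        proof (rule norm_laplace_integral_le)
          show "set_integrable lborel {0..} (\<lambda>p. exp (- of_nat n * of_real p) * X k (of_real p) $ i)"
            using elim(1) k by (intro set_integrable_laplace_component) (auto simp: borel_sum_converges_def)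
          show "\<nu> + 1 \<le> Re (of_nat n)" using elim(2) by simp
          show "norm (X k (of_real p) $ i) \<le> \<bar>K\<bar> / B ^ mi_abs k * exp (\<nu> * p)" if "0 \<le> p" for p
            using X_le[OF k nonneg_in_sectorial_nbhd[OF par(4) that]] that by simp
        qed
        moreover have "norm (mi_power C k) \<le> norm C ^ mi_abs k"
          by (rule norm_mi_power_le) (rule Finite_Cartesian_Product.norm_nth_le)
        ultimately have "norm (mi_power C k * I k n) \<le> norm C ^ mi_abs k * (\<bar>K\<bar> / B ^ mi_abs k)"
          unfolding norm_mult by (intro mult_mono) auto
        then show "norm (mi_power C k * I k n) \<le> \<bar>K\<bar> * (norm C / B) ^ mi_abs k"
          by (simp add: power_divide mult.commute)
      qed
    qed
    from conv zero show "\<forall>\<^sub>F n in sequentially.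
      (\<Sum>\<^sub>\<infinity>k\<in>J. exp (- mi_dot k \<mu> * of_nat n) * of_nat n powr mi_dot k a * (mi_power C k * I k n)) = 0"
    proof eventually_elim
      case (elim n)
      have comp: "borel_sum_term \<mu> a C X (of_nat n) k $ i =
          exp (- mi_dot k \<mu> * of_nat n) * of_nat n powr mi_dot k a * (mi_power C k * I k n)"
        if "k \<in> mindices L" for k
        using elim(1) that laplace_component[of "X k" "of_nat n" i]
        by (simp add: borel_sum_converges_def borel_sum_term_def I_def mult_ac)
      have "((\<lambda>k. borel_sum_term \<mu> a C X (of_nat n) k) has_sum 0) (mindices L)"
        using elim by (simp add: borel_sum_converges_def borel_sum_def has_sum_infsum flip: elim(2))
      from has_sum_bounded_linear[OF bounded_linear_vec_nth this, of i]
      have "(\<Sum>\<^sub>\<infinity>k\<in>mindices L. borel_sum_term \<mu> a C X (of_nat n) k $ i) = 0"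
        by (simp add: infsumI o_def)
      also have "(\<Sum>\<^sub>\<infinity>k\<in>mindices L. borel_sum_term \<mu> a C X (of_nat n) k $ i) =
          (\<Sum>\<^sub>\<infinity>k\<in>J. exp (- mi_dot k \<mu> * of_nat n) * of_nat n powr mi_dot k a * (mi_power C k * I k n))"
      proof (rule infsum_cong_neutral)
        \<comment> \<open>Outside \<open>J\<close> either C^k = 0 or the component vanishes on the
          whole ray of integration, so the term is 0 and the sum may be restricted to
          \<open>J\<close>.\<close>
        fix k assume k: "k \<in> mindices L - J"
        then have "mi_power C k = 0 \<or> (\<forall>p\<ge>0. X k (of_real p) $ i = 0)"
          using nonneg_in_sectorial_nbhd[OF par(4)] by (auto simp: J_def)
        then have "mi_power C k * I k n = 0"
        proof
          assume *: "\<forall>p\<ge>0. X k (of_real p) $ i = 0"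
          have "I k n = (LINT p:{0::real..}|lborel. 0)"
            unfolding I_def by (rule set_lebesgue_integral_cong) (use * in auto)
          then show ?thesis by simp
        qed simp
        then show "borel_sum_term \<mu> a C X (of_nat n) k $ i = 0"
          using k comp by simp
      next
        fix k assume "k \<in> mindices L \<inter> J"
        then show "borel_sum_term \<mu> a C X (of_nat n) k $ i =
            exp (- mi_dot k \<mu> * of_nat n) * of_nat n powr mi_dot k a * (mi_power C k * I k n)"
          using comp by simp
      qed (auto simp: J_def)
      finally show ?case .
    qed
  qed simp
  then show ?thesis
    using k by (auto simp: J_def)
qed

theorem theorem1p1:
  fixes \<Lambda> A :: "complex ^ 'm ^ 'm::finite"
    and g :: "'m mindex \<Rightarrow> complex \<Rightarrow> complex ^ 'm"
    and \<mu> a C :: "complex ^ 'm"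
    and L :: "'m set"
    and xt :: "'m mindex \<Rightarrow> complex fps ^ 'm"
    and X :: "'m mindex \<Rightarrow> complex \<Rightarrow> complex ^ 'm"
    and t0 :: real
    and x :: "nat \<Rightarrow> complex ^ 'm"
  assumes "admissible_nonlinearity g"
    and "lists_eigenvalues \<Lambda> (\<lambda>j. exp (- \<mu> $ j))"
    and "lists_eigenvalues A (\<lambda>j. a $ j)"
    and "nonresonant \<mu>"
    and "\<forall>j\<in>L. 0 < Re (\<mu> $ j)"
    and "transseries_solution \<Lambda> A g \<mu> a L C xt"
    and "borel_transforms L xt X"
    and "\<forall>t. t0 < Re t \<longrightarrow> borel_sum_converges \<mu> a L C X t"
    and "\<forall>n. t0 < real n \<longrightarrow> x n = borel_sum \<mu> a L C X (of_nat n)"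
    and "solves_for_large_n \<Lambda> A g x"
    and "finite {n. x n \<noteq> 0}"
  shows "\<forall>t. t0 < Re t \<longrightarrow> borel_sum \<mu> a L C X t = 0"
proof (intro allI impI)
  fix t assume t: "t0 < Re t"
  obtain B \<nu> \<epsilon> \<delta> K where par: "0 < B" "0 < \<nu>" "0 < \<epsilon>" "0 < \<delta>"
    and an: "\<forall>k\<in>mindices L. \<forall>i. (\<lambda>p. X k p $ i) analytic_on sectorial_nbhd \<epsilon> \<delta>"
    and bound: "\<forall>k\<in>mindices L. \<forall>p\<in>sectorial_nbhd \<epsilon> \<delta>.
           B ^ mi_abs k * exp (- \<nu> * norm p) * norm (X k p) \<le> K"
    using \<open>borel_transforms L xt X\<close> unfolding borel_transforms_def by blast
  have ev: "\<forall>\<^sub>F n in sequentially. t0 < real n"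
    by real_asymp
  have conv: "\<forall>\<^sub>F n in sequentially. borel_sum_converges \<mu> a L C X (of_nat n)"
    using ev by eventually_elim (use assms(8) in simp)
  have "\<forall>\<^sub>F n in sequentially. x n = 0"
    using \<open>finite {n. x n \<noteq> 0}\<close> by (simp add: cofinite_eq_sequentially[symmetric] eventually_cofinite)
  with ev have zero: "\<forall>\<^sub>F n in sequentially. borel_sum \<mu> a L C X (of_nat n) = 0"
    by eventually_elim (use assms(9) in simp)
  have "borel_sum_term \<mu> a C X t k = 0" if k: "k \<in> mindices L" for k
  proof (cases "mi_power C k = 0")
    case False
    \<comment> \<open>Collecting all components makes X_k vanish on the ray, a fact independent of
      t, so the term vanishes at the given complex t as well.\<close>
    have "X k (of_real p) = 0" if "0 \<le> p" for p
      using borel_transform_component_eq_0[OF assms(4,5) par _ bound conv zero k False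
          nonneg_in_sectorial_nbhd[OF par(4) that]] an
      by (simp add: vec_eq_iff)
    then have "indicator {0..} p *\<^sub>R laplace_integrand (X k) t p = 0" for p
      by (auto simp: laplace_integrand_def split: split_indicator)
    then have "laplace (X k) t = 0"
      unfolding laplace_def set_lebesgue_integral_def by (simp only: Bochner_Integration.integral_zero)
    then show ?thesis
      by (simp add: borel_sum_term_def)
  qed (simp add: borel_sum_term_def)
  then show "borel_sum \<mu> a L C X t = 0"
    unfolding borel_sum_def by (rule infsum_0)
qed

end
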